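(* Let $(C,e,\lambda,\oplus)$ be the free Catalan structure, and let $h,\mathrm{rev},\mathrm{corev}\colon C\to C$ be the maps defined in the context. Then $h=\mathrm{rev}\circ\mathrm{corev}\circ\mathrm{rev}$.
   Context: A Catalan structure is a quadruple $(C,e,\lambda,\oplus)$ where $C=\bigsqcup_{n\ge 0}C_n$ with $C_0=\{e\}$ ($|t|=n$ for $t\in C_n$), $\lambda\colon C_n\to C_{n+1}$, $\oplus\colon C_m\times C_n\to C_{m+n}$, $\oplus$ is associative with two-sided identity $e$, and every $t\in C$ can be written uniquely in exactly one of three forms: $t=e$; $t=\lambda(s)$ with $s\in C$ (indecomposable); $t=u\oplus v$ with $u$ indecomposable and $v\in C\setminus C_0$ (decomposable). Hence every nonempty $t$ is uniquely $\lambda(u)\oplus v$ ($v=e$ allowed). The free Catalan structure is realized by the formal expressions $e$, $\lambda(t)$, $\lambda(u)\oplus v$ with $v\ne e$; it is isomorphic to rooted plane trees written as lists of children, with $e=[\,]$, $\lambda(T)=[T]$, $\oplus$ = concatenation of child lists. Put $\gamma(t)=t\oplus\lambda(e)$ and define $\ominus$ by $e\ominus v=v$, $\lambda(u)\ominus v=\lambda(u\ominus v)$, $(t\oplus u)\ominus v=t\oplus(u\ominus v)$ for $t,u\ne e$ (well defined; one may take $t$ indecomposable). The maps (with $u,v\in C$ arbitrary, $v=e$ allowed): $h(e)=e$, $h(\lambda(u)\oplus v)=h(v)\ominus\gamma(h(u))$; $\mathrm{rev}(e)=e$, $\mathrm{rev}(\lambda(u)\oplus v)=\mathrm{rev}(v)\oplus\lambda(\mathrm{rev}(u))$;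 $\mathrm{corev}(e)=e$, $\mathrm{corev}(\lambda(u)\oplus v)=\lambda(\mathrm{corev}(v))\oplus\mathrm{corev}(u)$. *)

theory Defs
  imports Main
begin

text \<open>The grading is given by the family \<open>C\<close>; the underlying set is its disjoint union.\<close>

locale catalan_structure =
  fixes C :: "nat \<Rightarrow> 'a set"
    and e :: 'a
    and lam :: "'a \<Rightarrow> 'a"
    and plus :: "'a \<Rightarrow> 'a \<Rightarrow> 'a"
  assumes disjoint: "m \<noteq> n \<Longrightarrow> C m \<inter> C n = {}"
    and C_0: "C 0 = {e}"
    and lam_closed: "t \<in> C n \<Longrightarrow> lam t \<in> C (Suc n)"
    and plus_closed: "s \<in> C m \<Longrightarrow> t \<in> C n \<Longrightarrow> plus s t \<in> C (m + n)"
    and plus_assoc: "\<lbrakk>r \<in> (\<Union>n. C n); s \<in> (\<Union>n. C n); t \<in> (\<Union>n. C n)\<rbrakk>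
      \<Longrightarrow> plus (plus r s) t = plus r (plus s t)"
    and plus_e_left: "t \<in> (\<Union>n. C n) \<Longrightarrow> plus e t = t"
    and plus_e_right: "t \<in> (\<Union>n. C n) \<Longrightarrow> plus t e = t"
    and forms_exhaustive: "t \<in> (\<Union>n. C n) \<Longrightarrow>
      t = e \<or> t \<in> lam ` (\<Union>n. C n) \<or>
      (\<exists>u \<in> lam ` (\<Union>n. C n). \<exists>v \<in> (\<Union>n. C n) - C 0. t = plus u v)"
    and forms_exclusive:
      "s \<in> (\<Union>n. C n) \<Longrightarrow> lam s \<noteq> e"
      "\<lbrakk>u \<in> lam ` (\<Union>n. C n); v \<in> (\<Union>n. C n) - C 0\<rbrakk> \<Longrightarrow> plus u v \<noteq> e"
      "\<lbrakk>s \<in> (\<Union>n. C n); u \<in> lam ` (\<Union>n. C n); v \<in> (\<Union>n. C n) - C 0\<rbrakk> \<Longrightarrow> plus u v \<noteq> lam s"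
    and lam_unique: "inj_on lam (\<Union>n. C n)"
    and plus_unique:
      "\<lbrakk>u \<in> lam ` (\<Union>n. C n); v \<in> (\<Union>n. C n) - C 0;
        u' \<in> lam ` (\<Union>n. C n); v' \<in> (\<Union>n. C n) - C 0; plus u v = plus u' v'\<rbrakk>
       \<Longrightarrow> u = u' \<and> v = v'"

text \<open>
  The free Catalan structure, realized by rooted plane trees: a tree is the list of the subtrees
  at the children of its root, and \<open>Node (u # us)\<close> is \<open>\<lambda>(u) \<oplus> Node us\<close>.
\<close>

datatype tree = Node "tree list"

fun children :: "tree \<Rightarrow> tree list" where
  "children (Node ts) = ts"

definition emp :: tree where
  "emp = Node []"

definition lam :: "tree \<Rightarrow> tree" where
  "lam t = Node [t]"

definition oplus :: "tree \<Rightarrow> tree \<Rightarrow> tree" (infixl "\<oplus>" 65) where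
  "s \<oplus> t = Node (children s @ children t)"

text \<open>The number of edges, which is the degree \<open>|t|\<close>.\<close>

fun edges :: "tree \<Rightarrow> nat" where
  "edges (Node []) = 0"
| "edges (Node (u # us)) = Suc (edges u) + edges (Node us)"

definition grade :: "nat \<Rightarrow> tree set" where
  "grade n = {t. edges t = n}"

lemma Node_Cons: "Node (u # us) = lam u \<oplus> Node us"
  by (simp add: lam_def oplus_def)

lemma edges_Node_append: "edges (Node (us @ vs)) = edges (Node us) + edges (Node vs)"
  by (induction us) auto

lemma edges_oplus: "edges (s \<oplus> t) = edges s + edges t"
  by (cases s; cases t) (simp add: oplus_def edges_Node_append)

lemma edges_eq_0_iff: "edges t = 0 \<longleftrightarrow> t = emp"
  by (cases t rule: edges.cases) (auto simp: emp_def)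

lemma UN_grade: "(\<Union>n. grade n) = UNIV"
  by (auto simp: grade_def)

lemma grade_0: "grade 0 = {emp}"
  by (auto simp: grade_def edges_eq_0_iff)

interpretation tree: catalan_structure grade emp lam oplus
proof (unfold_locales, unfold UN_grade grade_0)
  fix t :: tree
  show "t = emp \<or> t \<in> range lam \<or> (\<exists>u \<in> range lam. \<exists>v \<in> UNIV - {emp}. t = u \<oplus> v)"
  proof (cases t rule: edges.cases)
    case (2 u us)
    show ?thesis
    proof (cases us)
      case Nil
      with 2 show ?thesis by (simp add: lam_def)
    next
      case (Cons w ws)
      then have "Node us \<in> UNIV - {emp}" by (simp add: emp_def)
      with 2 show ?thesis unfolding Node_Cons by blast
    qed
  qed (simp add: emp_def)
next
  fix u v s :: tree
  assume "u \<in> range lam" "v \<in> UNIV - {emp}"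
  then show "u \<oplus> v \<noteq> emp" "u \<oplus> v \<noteq> lam s"
    by (cases v; auto simp: emp_def lam_def oplus_def)+
next
  fix u v u' v' :: tree
  assume "u \<in> range lam" "u' \<in> range lam" "u \<oplus> v = u' \<oplus> v'"
  then show "u = u' \<and> v = v'"
    by (cases v; cases v') (auto simp: lam_def oplus_def)
next
  fix t :: tree
  show "emp \<oplus> t = t" "t \<oplus> emp = t"
    by (cases t; simp add: emp_def oplus_def)+
next
  fix s t :: tree and m n :: nat
  assume "s \<in> grade m" "t \<in> grade n"
  then show "s \<oplus> t \<in> grade (m + n)"
    by (simp add: grade_def edges_oplus)
qed (auto simp: grade_def inj_on_def lam_def emp_def oplus_def)

text \<open>Freeness: every Catalan structure receives exactly one morphism from the trees.\<close>

theorem tree_initial: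
  fixes C :: "nat \<Rightarrow> 'a set"
  assumes "catalan_structure C e l p"
  shows "\<exists>!f. f emp = e \<and> (\<forall>t. f (lam t) = l (f t)) \<and> (\<forall>s t. f (s \<oplus> t) = p (f s) (f t))
    \<and> (\<forall>n. \<forall>t \<in> grade n. f t \<in> C n)"
proof -
  interpret catalan_structure C e l p by fact
  define f where "f = rec_tree (\<lambda>ts. foldr (\<lambda>x. p (l (snd x))) ts e)"
  have f_Nil: "f (Node []) = e" and f_Cons: "f (Node (u # us)) = p (l (f u)) (f (Node us))" for u us
    by (simp_all add: f_def)
  have grd: "f t \<in> C (edges t)" for t
  proof (induction t rule: edges.induct)
    case 1
    then show ?case by (simp add: f_Nil C_0)
  next
    case (2 u us)
    then show ?case
      unfolding f_Cons edges.simps by (intro plus_closed lam_closed)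
  qed
  then have mem: "f t \<in> (\<Union>n. C n)" for t by blast
  have lmem: "l (f t) \<in> (\<Union>n. C n)" for t using lam_closed[OF grd] by blast
  have app: "f (Node (us @ vs)) = p (f (Node us)) (f (Node vs))" for us vs
    by (induction us) (simp_all only: append_Nil append_Cons f_Nil f_Cons plus_e_left mem
        plus_assoc[OF lmem mem mem])
  show ?thesis
  proof (intro ex1I[of _ f] conjI allI ballI)
    show "f emp = e" by (simp add: emp_def f_Nil)
    show "f (lam t) = l (f t)" for t
      unfolding lam_def f_Cons f_Nil by (rule plus_e_right[OF lmem])
    show "f (s \<oplus> t) = p (f s) (f t)" for s t
      by (cases s; cases t) (simp add: oplus_def app)
    show "f t \<in> C n" if "t \<in> grade n" for n t
      using that grd[of t] by (simp add: grade_def)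
  next
    fix g
    assume g: "g emp = e \<and> (\<forall>t. g (lam t) = l (g t)) \<and> (\<forall>s t. g (s \<oplus> t) = p (g s) (g t))
      \<and> (\<forall>n. \<forall>t \<in> grade n. g t \<in> C n)"
    show "g = f"
    proof
      fix t
      show "g t = f t"
      proof (induction t rule: edges.induct)
        case 1
        then show ?case using g by (simp add: f_Nil emp_def)
      next
        case (2 u us)
        then show ?case using g unfolding f_Cons unfolding Node_Cons by simp
      qed
    qed
  qed
qed

definition gam :: "tree \<Rightarrow> tree" where
  "gam t = t \<oplus> lam emp"

text \<open>
  The last clause takes the indecomposable first summand; \<open>ominus_oplus\<close> below is the rule
  for arbitrary nonempty summands.
\<close>

fun ominus :: "tree \<Rightarrow> tree \<Rightarrow> tree" (infixl "\<ominus>" 65) where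
  "Node [] \<ominus> v = v"
| "Node [u] \<ominus> v = lam (u \<ominus> v)"
| "Node (u # w # ws) \<ominus> v = lam u \<oplus> (Node (w # ws) \<ominus> v)"

fun h :: "tree \<Rightarrow> tree" where
  "h (Node []) = emp"
| "h (Node (u # us)) = h (Node us) \<ominus> gam (h u)"

fun tree_rev :: "tree \<Rightarrow> tree" where
  "tree_rev (Node []) = emp"
| "tree_rev (Node (u # us)) = tree_rev (Node us) \<oplus> lam (tree_rev u)"

fun tree_corev :: "tree \<Rightarrow> tree" where
  "tree_corev (Node []) = emp"
| "tree_corev (Node (u # us)) = lam (tree_corev (Node us)) \<oplus> tree_corev u"

lemma ominus_emp: "emp \<ominus> v = v"
  by (simp add: emp_def)

lemma ominus_lam: "lam u \<ominus> v = lam (u \<ominus> v)"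
  by (simp add: lam_def)

lemma ominus_oplus:
  assumes "t \<noteq> emp" "u \<noteq> emp"
  shows "(t \<oplus> u) \<ominus> v = t \<oplus> (u \<ominus> v)"
proof -
  obtain ts w ws where t: "t = Node ts" and u: "u = Node (w # ws)"
    using assms(2) by (cases t; cases u rule: edges.cases) (auto simp: emp_def)
  have "Node (ts @ w # ws) \<ominus> v = Node ts \<oplus> (Node (w # ws) \<ominus> v)"
  proof (induction ts)
    case Nil
    then show ?case using tree.plus_e_left[of "Node (w # ws) \<ominus> v"] by (simp add: UN_grade emp_def)
  next
    case (Cons a ts)
    then show ?case by (cases ts) (auto simp: lam_def oplus_def)
  qed
  then show ?thesis by (simp add: t u oplus_def)
qed

lemma h_lam_oplus: "h emp = emp" "h (lam u \<oplus> v) = h v \<ominus> gam (h u)"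
  by (cases v; simp add: emp_def lam_def oplus_def)+

lemma tree_rev_lam_oplus:
  "tree_rev emp = emp" "tree_rev (lam u \<oplus> v) = tree_rev v \<oplus> lam (tree_rev u)"
  by (cases v; simp add: emp_def lam_def oplus_def)+

lemma tree_corev_lam_oplus:
  "tree_corev emp = emp" "tree_corev (lam u \<oplus> v) = lam (tree_corev v) \<oplus> tree_corev u"
  by (cases v; simp add: emp_def lam_def oplus_def)+

end

(* The map rev o corev turns concatenation into \<ominus>: grafting at the end of the list of children
   becomes grafting at the end of the rightmost branch. Since rev appends \<lambda>(rev u) at the end, the
   composite rev o corev o rev satisfies the recursion that defines h. *)
theory Submission
  imports Defs
begin

lemma oplus_assoc: "(r \<oplus> s) \<oplus> t = r \<oplus> (s \<oplus> t)"
  by (simp add: oplus_def)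

lemma oplus_emp_left: "emp \<oplus> t = t"
  by (cases t) (simp add: oplus_def emp_def)

lemma oplus_emp_right: "t \<oplus> emp = t"
  by (cases t) (simp add: oplus_def emp_def)

text \<open>\<open>\<ominus>\<close> only changes the last child of the root. The empty
  \<open>s\<close> is treated apart because \<open>ominus_oplus\<close> needs nonempty
  summands.\<close>

lemma oplus_lam_ominus: "(s \<oplus> lam x) \<ominus> v = s \<oplus> lam (x \<ominus> v)"
proof (cases "s = emp")
  case True
  then show ?thesis by (simp add: oplus_emp_left ominus_lam)
next
  case False
  moreover have "lam x \<noteq> emp" by (simp add: lam_def emp_def)
  ultimately show ?thesis by (simp add: ominus_oplus ominus_lam)
qed

lemma tree_rev_corev_lam_oplus:
  "tree_rev (tree_corev (lam u \<oplus> v)) = tree_rev (tree_corev u) \<oplus> lam (tree_rev (tree_corev v))"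
  by (simp add: tree_corev_lam_oplus tree_rev_lam_oplus)

lemma tree_rev_corev_oplus:
  "tree_rev (tree_corev (s \<oplus> t)) = tree_rev (tree_corev s) \<ominus> tree_rev (tree_corev t)"
proof (induction s rule: edges.induct)
  case 1
  then show ?case
    by (simp add: oplus_emp_left ominus_emp tree_corev_lam_oplus tree_rev_lam_oplus flip: emp_def)
next
  case (2 u us)
  then show ?case
    \<comment> \<open>The tail \<open>Node us \<oplus> t\<close> is sent into the last child, where
      \<open>\<ominus>\<close> recurses, so the hypothesis for \<open>Node us\<close> applies
      there.\<close>
    unfolding Node_Cons oplus_assoc tree_rev_corev_lam_oplus oplus_lam_ominus by simp
qed

text \<open>The empty tail of \<open>lam u\<close> becomes the leaf appended by
  \<open>gam\<close>.\<close>

lemma tree_rev_corev_lam: "tree_rev (tree_corev (lam u)) = gam (tree_rev (tree_corev u))"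
  using tree_rev_corev_lam_oplus[of u emp]
  by (simp add: oplus_emp_right tree_corev_lam_oplus tree_rev_lam_oplus gam_def)

theorem theorem5p3: "h = tree_rev \<circ> tree_corev \<circ> tree_rev"
proof
  fix t
  show "h t = (tree_rev \<circ> tree_corev \<circ> tree_rev) t"
  proof (induction t rule: edges.induct)
    case 1
    then show ?case by (simp add: emp_def)
  next
    case (2 u us)
    then show ?case by (simp add: tree_rev_corev_oplus tree_rev_corev_lam)
  qed
qed

end
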